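(* Let \(A\) be a subset of \(\mathbb{R}^{+}\). Then \(A\) is the distance set of some infinite totally bounded ultrametric space \((X, d)\) if and only if the following conditions simultaneously hold: (i) \(A\) has the order type \(\mathbf{1} + \boldsymbol{\omega}^{*}\) as a subposet of \((\mathbb{R}^{+}, \leqslant)\). (ii) The point \(0\) is an accumulation point of \(A\) with respect to the standard Euclidean metric on \(\mathbb{R}^{+}\).
   Context: \(\mathbb{R}^{+}\) is the set of all nonnegative real numbers with its standard order \(\leqslant\). An ultrametric on \(X\) is a metric \(d\colon X\times X\to\mathbb{R}^{+}\) satisfying \(d(x,y)\leqslant\max\{d(x,z),d(z,y)\}\) for all \(x,y,z\in X\). The distance set of an ultrametric space \((X,d)\) is \(D(X,d)=\{d(x,y): x,y\in X\}\). A metric space \((X,d)\) is totally bounded if for every \(r>0\) it is covered by finitely many open balls \(B_r(c)=\{x\in X: d(c,x)<r\}\), \(c\in X\). A poset has the order type \(\mathbf{1}+\boldsymbol{\omega}^{*}\) if it is order isomorphic to the totally ordered set \(\{-\infty\}\cup\{\ldots,-3,-2,-1\}\), where the negative integers carry the usual order and \(-\infty\) is the smallest element. A point \(p\) of a metric space \((Y,\rho)\) is isolated if there is \(\varepsilon>0\) such that \(\rho(p,y)>\varepsilon\) for every \(y\in Y\setminus\{p\}\); a point \(p\in Y\) that is not isolated is called an accumulation point of \(Y\) (so accumulation points of \(Y\) belong to \(Y\)). *)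

theory Defs
  imports "HOL-Analysis.Analysis"
begin

locale Ultrametric_space = Metric_space M d
  for M :: "'a set" and d :: "'a \<Rightarrow> 'a \<Rightarrow> real" +
  assumes ultra: "\<lbrakk>x \<in> M; y \<in> M; z \<in> M\<rbrakk> \<Longrightarrow> d x y \<le> max (d x z) (d z y)"

definition distance_set :: "'a set \<Rightarrow> ('a \<Rightarrow> 'a \<Rightarrow> real) \<Rightarrow> real set" where
  "distance_set M d = {d x y | x y. x \<in> M \<and> y \<in> M}"

text \<open>Subsets of an ordered type are regarded as subposets, with the induced order.\<close>

definition order_isomorphic :: "'a::order set \<Rightarrow> 'b::order set \<Rightarrow> bool" where
  "order_isomorphic P Q \<longleftrightarrow>
     (\<exists>f. bij_betw f P Q \<and> (\<forall>x\<in>P. \<forall>y\<in>P. x \<le> y \<longleftrightarrow> f x \<le> f y))"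

text \<open>The model of \<open>1 + \<omega>\<^sup>*\<close>: the negative integers together with a least element
  \<open>-\<infinity>\<close>, realised inside the extended reals with their usual order.\<close>

definition one_plus_omega_star :: "ereal set" where
  "one_plus_omega_star = insert (-\<infinity>) {ereal (of_int k) | k. k < 0}"

definition has_order_type_one_plus_omega_star :: "'a::order set \<Rightarrow> bool" where
  "has_order_type_one_plus_omega_star P \<longleftrightarrow> order_isomorphic P one_plus_omega_star"

text \<open>Unlike a limit point (\<^const>\<open>islimpt\<close>), an accumulation point of \<open>Y\<close> is required to belong
  to \<open>Y\<close>.\<close>

definition accumulation_point_of :: "'a::metric_space \<Rightarrow> 'a set \<Rightarrow> bool" where
  "accumulation_point_of p Y \<longleftrightarrow> p \<in> Y \<and> \<not> p isolated_in Y"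

end

theory Submission
  imports Defs
begin

text \<open>
  Both sides say that \<open>A\<close> contains 0, contains arbitrarily small positive elements, and has
  only finitely many elements above each \<open>r > 0\<close>, that is, that \<open>A\<close> consists of 0 and of a
  sequence decreasing strictly to 0.

  For the order-theoretic side, counting the elements of \<open>A\<close> above a given positive element
  labels the positive part of \<open>A\<close> by the negative integers; conversely, an isomorphism must
  send 0, the least element, to \<open>-\<infinity>\<close>, so each positive element has finitely many elements
  above it (\<open>order_type_accumulating_at_zero_iff\<close>).

  For the metric side, the strong triangle inequality makes distances rigid: a distance that is
  at least \<open>r\<close> does not change when its endpoints move by less than \<open>r\<close>. Hence a finite
  cover by \<open>r\<close>-balls leaves only the finitely many distances between centres as possible
  distances \<open>\<ge> r\<close>, while in an infinite space some ball of the cover holds two points, which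
  gives a positive distance \<open>< r\<close>. Conversely, \<open>max a b\<close> for \<open>a \<noteq> b\<close> is an ultrametric on
  \<open>A\<close> itself. Its distance set is \<open>A\<close>, because \<open>a\<close> is the distance from \<open>a\<close> to 0, and it is
  totally bounded, because the ball around 0 contains all but finitely many points. As \<open>A\<close> is
  countable, this space can be copied into any infinite type.
\<close>

section \<open>Sets of reals decreasing to zero\<close>

definition decreases_to_zero :: "real set \<Rightarrow> bool" where
  "decreases_to_zero A \<longleftrightarrow>
     0 \<in> A \<and> (\<forall>r>0. finite {a \<in> A. r \<le> a}) \<and> (\<forall>r>0. \<exists>a\<in>A. 0 < a \<and> a < r)"

lemma accumulation_point_of_zero_iff:
  fixes A :: "real set"
  assumes "A \<subseteq> {0..}"
  shows "accumulation_point_of 0 A \<longleftrightarrow> 0 \<in> A \<and> (\<forall>r>0. \<exists>a\<in>A. 0 < a \<and> a < r)"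
proof -
  have "(0 islimpt A) \<longleftrightarrow> (\<forall>r>0. \<exists>a\<in>A. 0 < a \<and> a < r)"
    unfolding islimpt_approachable using assms
    by (intro all_cong1 imp_cong refl bex_cong) (auto simp: less_le)
  then show ?thesis
    by (auto simp: accumulation_point_of_def isolated_in_islimpt_iff)
qed

lemma infinite_positive_part:
  assumes "decreases_to_zero A"
  shows "infinite {a \<in> A. 0 < a}"
proof
  assume fin: "finite {a \<in> A. 0 < a}"
  have "{a \<in> A. 0 < a} \<noteq> {}"
    using assms zero_less_one unfolding decreases_to_zero_def by blast
  with fin have "Min {a \<in> A. 0 < a} \<in> {a \<in> A. 0 < a}"
    by (rule Min_in)
  then obtain a where "a \<in> A" "0 < a" "a < Min {a \<in> A. 0 < a}"
    using assms unfolding decreases_to_zero_def by blast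
  with Min_le[OF fin, of a] show False
    by simp
qed

lemma countable_decreases_to_zero:
  assumes "A \<subseteq> {0..}" "decreases_to_zero A"
  shows "countable A"
proof -
  have "A \<subseteq> insert 0 (\<Union>n. {a \<in> A. 1 / real (Suc n) \<le> a})"
  proof
    fix a assume "a \<in> A"
    with assms have "a = 0 \<or> 0 < a" by force
    then show "a \<in> insert 0 (\<Union>n. {a \<in> A. 1 / real (Suc n) \<le> a})"
    proof
      assume "0 < a"
      then obtain n where "1 / real (Suc n) < a"
        using nat_approx_posE by blast
      with \<open>a \<in> A\<close> show ?thesis by (auto intro: less_imp_le)
    qed simp
  qed
  moreover have "finite {a \<in> A. 1 / real (Suc n) \<le> a}" for n
    using assms(2) unfolding decreases_to_zero_def by simp
  then have "countable (insert 0 (\<Union>n. {a \<in> A. 1 / real (Suc n) \<le> a}))"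
    by (simp add: countable_finite del: of_nat_Suc)
  ultimately show ?thesis
    by (rule countable_subset)
qed

section \<open>The order type\<close>

text \<open>Below any finite set of largest elements there is a next largest one, since only finitely
  many elements lie above any fixed element of the infinite remainder.\<close>

lemma ex_element_with_rank_from_top:
  fixes S :: "'b::linorder set"
  assumes "infinite S" and fin: "\<And>a. a \<in> S \<Longrightarrow> finite {b \<in> S. a \<le> b}"
  shows "\<exists>a\<in>S. card {b \<in> S. a \<le> b} = Suc n"
proof -
  have next_largest: "\<exists>a\<in>S - F. \<forall>b\<in>S - F. b \<le> a" if "finite F" for F
  proof -
    obtain c where c: "c \<in> S - F"
      using \<open>infinite S\<close> \<open>finite F\<close> by (metis Diff_infinite_finite finite.emptyI ex_in_conv)
    define T where "T = {b \<in> S - F. c \<le> b}"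
    have T: "finite T" "c \<in> T"
      using fin[of c] c by (auto simp: T_def elim: finite_subset[rotated])
    have "b \<le> Max T" if "b \<in> S - F" for b
    proof (cases "c \<le> b")
      case True
      with that \<open>finite T\<close> show ?thesis by (simp add: T_def)
    next
      case False
      then have "b \<le> c" by simp
      also have "c \<le> Max T" using T by simp
      finally show ?thesis .
    qed
    moreover have "Max T \<in> S - F"
      using Max_in[of T] T by (auto simp: T_def)
    ultimately show ?thesis by blast
  qed
  show ?thesis
  proof (induction n)
    case 0
    obtain a where "a \<in> S" "\<forall>b\<in>S. b \<le> a"
      using next_largest[of "{}"] by auto
    moreover from this have "{b \<in> S. a \<le> b} = {a}" by force
    ultimately show ?case by (intro bexI[of _ a]) auto
  next
    case (Suc n)
    then obtain a where a: "a \<in> S" "card {b \<in> S. a \<le> b} = Suc n" by blast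
    obtain a' where a': "a' \<in> S - {b \<in> S. a \<le> b}"
        "\<forall>b\<in>S - {b \<in> S. a \<le> b}. b \<le> a'"
      using next_largest[OF fin[OF a(1)]] by blast
    then have "a' < a" by auto
    with a' have "{b \<in> S. a' \<le> b} = insert a' {b \<in> S. a \<le> b}"
      by (auto intro: order_antisym)
    then show ?case
      using a a' fin[OF a(1)] by (intro bexI[of _ a']) auto
  qed
qed

lemma order_type_if_decreases_to_zero:
  assumes "A \<subseteq> {0..}" "decreases_to_zero A"
  shows "has_order_type_one_plus_omega_star A"
proof -
  define S where "S = {a \<in> A. 0 < a}"
  define rank where "rank a = card {b \<in> S. a \<le> b}" for a
  define f where "f a = (if a = 0 then -\<infinity> else ereal (of_int (- int (rank a))))" for a
  have A: "A = insert 0 S"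
    using assms unfolding S_def decreases_to_zero_def by force
  have S_pos: "0 < a" if "a \<in> S" for a
    using that by (simp add: S_def)
  have fin: "finite {b \<in> S. a \<le> b}" if "a \<in> S" for a
    using assms(2) S_pos[OF that] unfolding decreases_to_zero_def S_def
    by (auto elim!: allE[of _ a] elim: finite_subset[rotated])
  have rank_pos: "0 < rank a" if "a \<in> S" for a
    using fin[OF that] that by (auto simp: rank_def card_gt_0_iff)
  have rank_less: "rank b < rank a" if "a \<in> S" "b \<in> S" "a < b" for a b
    unfolding rank_def
  proof (rule psubset_card_mono[OF fin[OF that(1)]])
    have "a \<in> {c \<in> S. a \<le> c}" "a \<notin> {c \<in> S. b \<le> c}"
      using that by auto
    moreover have "{c \<in> S. b \<le> c} \<subseteq> {c \<in> S. a \<le> c}"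
      using that by auto
    ultimately show "{c \<in> S. b \<le> c} \<subset> {c \<in> S. a \<le> c}" by blast
  qed
  have rank_le: "rank b \<le> rank a \<longleftrightarrow> a \<le> b" if "a \<in> S" "b \<in> S" for a b
    using rank_less[OF that] rank_less[OF that(2,1)] by (cases a b rule: linorder_cases) auto
  have f_le: "a \<le> b \<longleftrightarrow> f a \<le> f b" if ab: "a \<in> A" "b \<in> A" for a b
  proof -
    consider "a = 0" | "a \<in> S" "b = 0" | "a \<in> S" "b \<in> S"
      using ab by (auto simp: A)
    then show ?thesis
    proof cases
      case 1
      with ab assms(1) show ?thesis by (auto simp: f_def)
    next
      case 2
      then show ?thesis using S_pos[of a] by (simp add: f_def)
    next
      case 3
      then show ?thesis using S_pos[of a] S_pos[of b] rank_le[of a b] by (simp add: f_def)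
    qed
  qed
  have "f a = f b \<Longrightarrow> a = b" if "a \<in> A" "b \<in> A" for a b
    using f_le[OF that] f_le[OF that(2,1)] by (simp add: order_antisym)
  then have inj: "inj_on f A"
    by (auto intro: inj_onI)
  have "f ` A = one_plus_omega_star"
  proof
    show "f ` A \<subseteq> one_plus_omega_star"
      using rank_pos S_pos unfolding A f_def one_plus_omega_star_def
      by (auto intro!: exI[of _ "- int (rank _)"])
    show "one_plus_omega_star \<subseteq> f ` A"
    proof
      fix x assume "x \<in> one_plus_omega_star"
      then consider "x = -\<infinity>" | k where "k < 0" "x = ereal (of_int k)"
        unfolding one_plus_omega_star_def by blast
      then show "x \<in> f ` A"
      proof cases
        case 1
        then show ?thesis by (auto simp: A f_def)
      next
        case (2 k)
        have "infinite S"
          using infinite_positive_part[OF assms(2)] by (simp add: S_def)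
        then obtain a where a: "a \<in> S" "rank a = Suc (nat (- k - 1))"
          using ex_element_with_rank_from_top[of S] fin unfolding rank_def by blast
        then have "f a = x"
          using 2 S_pos[OF a(1)] by (simp add: f_def)
        then show ?thesis using a(1) A by blast
      qed
    qed
  qed
  with inj f_le show ?thesis
    unfolding has_order_type_one_plus_omega_star_def order_isomorphic_def bij_betw_def by blast
qed

lemma finite_above_if_order_type:
  fixes A :: "real set"
  assumes "A \<subseteq> {0..}" "0 \<in> A" "has_order_type_one_plus_omega_star A" "a \<in> A" "0 < a"
  shows "finite {b \<in> A. a \<le> b}"
proof -
  obtain f where bij: "bij_betw f A one_plus_omega_star"
    and mono: "\<forall>x\<in>A. \<forall>y\<in>A. x \<le> y \<longleftrightarrow> f x \<le> f y"
    using assms(3) unfolding has_order_type_one_plus_omega_star_def order_isomorphic_def by blast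
  have "-\<infinity> \<in> f ` A"
    using bij by (simp add: bij_betw_def one_plus_omega_star_def)
  then obtain b where b: "b \<in> A" "f b = -\<infinity>" by force
  with mono \<open>0 \<in> A\<close> have "b \<le> 0" by force
  with b assms(1) have f0: "f 0 = -\<infinity>" by force
  have f_int: "\<exists>k<0. f x = ereal (of_int k)" if "x \<in> A" "0 < x" for x
  proof -
    have "f x \<noteq> -\<infinity>"
      using mono f0 \<open>0 \<in> A\<close> that by force
    moreover have "f x \<in> one_plus_omega_star"
      using bij that(1) by (auto simp: bij_betw_def)
    ultimately show ?thesis
      by (auto simp: one_plus_omega_star_def)
  qed
  obtain k where k: "f a = ereal (of_int k)"
    using f_int assms by blast
  have "f ` {b \<in> A. a \<le> b} \<subseteq> (\<lambda>j. ereal (of_int j)) ` {k..<0}"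
  proof (clarify)
    fix x assume x: "x \<in> A" "a \<le> x"
    then obtain j where j: "j < 0" "f x = ereal (of_int j)"
      using f_int[of x] assms(5) by auto
    have "f a \<le> f x" using mono x assms(4) by blast
    with j k show "f x \<in> (\<lambda>j. ereal (of_int j)) ` {k..<0}" by auto
  qed
  then have "finite (f ` {b \<in> A. a \<le> b})"
    by (rule finite_subset) simp
  moreover have "inj_on f {b \<in> A. a \<le> b}"
    using bij by (auto simp: bij_betw_def elim: inj_on_subset)
  ultimately show ?thesis
    by (rule finite_imageD)
qed

lemma order_type_accumulating_at_zero_iff:
  assumes "A \<subseteq> {0..}"
  shows "has_order_type_one_plus_omega_star A \<and> accumulation_point_of 0 A \<longleftrightarrow>
         decreases_to_zero A" (is "?L \<longleftrightarrow> ?R")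
proof
  assume ?L
  then have zero: "0 \<in> A" and small: "\<forall>r>0. \<exists>a\<in>A. 0 < a \<and> a < r"
    using accumulation_point_of_zero_iff[OF assms] by auto
  have "finite {b \<in> A. r \<le> b}" if "0 < r" for r
  proof -
    obtain a where a: "a \<in> A" "0 < a" "a < r"
      using small \<open>0 < r\<close> by blast
    then have "finite {b \<in> A. a \<le> b}"
      using finite_above_if_order_type[OF assms zero] \<open>?L\<close> by blast
    then show ?thesis
      by (rule finite_subset[rotated]) (use a in auto)
  qed
  with zero small show ?R
    unfolding decreases_to_zero_def by blast
next
  assume ?R
  then show ?L
    using order_type_if_decreases_to_zero[OF assms] accumulation_point_of_zero_iff[OF assms]
    by (auto simp: decreases_to_zero_def)
qed

section \<open>Distance sets of totally bounded ultrametric spaces\<close>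

context Ultrametric_space
begin

text \<open>In an ultrametric triangle the two longest sides are equal. Applied once at each endpoint,
  this shows that moving both endpoints by less than their distance does not change the distance.\<close>

lemma dist_eq_if_closer:
  assumes "x \<in> M" "y \<in> M" "c \<in> M" "d c x < d x y"
  shows "d c y = d x y"
proof (rule antisym)
  show "d c y \<le> d x y"
    using ultra[OF assms(3,2,1)] assms(4) by simp
  show "d x y \<le> d c y"
    using ultra[OF assms(1-3)] assms(4) commute[of x c] by simp
qed

lemma finite_large_distances:
  assumes "mtotally_bounded M" "0 < r"
  shows "finite {a \<in> distance_set M d. r \<le> a}"
proof -
  obtain K where K: "finite K" "K \<subseteq> M" "M \<subseteq> (\<Union>c\<in>K. mball c r)"
    using assms unfolding mtotally_bounded_def by metis
  have "{a \<in> distance_set M d. r \<le> a} \<subseteq> (\<lambda>(b, c). d b c) ` (K \<times> K)"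
  proof
    fix a assume "a \<in> {a \<in> distance_set M d. r \<le> a}"
    then obtain x y where xy: "x \<in> M" "y \<in> M" "a = d x y" "r \<le> d x y"
      by (auto simp: distance_set_def)
    obtain b c where bc: "b \<in> K" "x \<in> mball b r" "c \<in> K" "y \<in> mball c r"
      using xy(1,2) K(3) by blast
    then have bc: "b \<in> K" "c \<in> K" "d b x < r" "d c y < r"
      by (auto simp: in_mball)
    have 1: "d b y = d x y"
      using xy bc K(2) by (intro dist_eq_if_closer) auto
    then have "d c y < d y b"
      using xy(4) bc(4) commute[of y b] by simp
    then have "d c b = d y b"
      using xy(2) bc K(2) by (intro dist_eq_if_closer) auto
    with 1 xy(3) have "a = d b c"
      using commute[of c b] commute[of y b] by simp
    with bc show "a \<in> (\<lambda>(b, c). d b c) ` (K \<times> K)" by auto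
  qed
  then show ?thesis
    by (rule finite_subset) (simp add: K(1))
qed

lemma ex_small_distance:
  assumes "mtotally_bounded M" "infinite M" "0 < r"
  shows "\<exists>a\<in>distance_set M d. 0 < a \<and> a < r"
proof -
  obtain K where K: "finite K" "K \<subseteq> M" "M \<subseteq> (\<Union>c\<in>K. mball c r)"
    using assms unfolding mtotally_bounded_def by metis
  have "infinite (\<Union>c\<in>K. mball c r)"
    using K(3) \<open>infinite M\<close> finite_subset by blast
  then obtain c where c: "c \<in> K" "infinite (mball c r)"
    using K(1) by blast
  then have "infinite (mball c r - {c})" by simp
  then obtain x where "x \<in> mball c r - {c}"
    by (metis finite.emptyI ex_in_conv)
  then have x: "x \<in> M" "c \<in> M" "d c x < r" "x \<noteq> c"
    by (auto simp: in_mball)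
  then have "0 < d c x" by simp
  moreover have "d c x \<in> distance_set M d"
    unfolding distance_set_def using x(1,2) by blast
  ultimately show ?thesis
    using x(3) by blast
qed

lemma distance_set_decreases_to_zero:
  assumes "mtotally_bounded M" "infinite M"
  shows "decreases_to_zero (distance_set M d)"
proof -
  obtain x where "x \<in> M"
    using \<open>infinite M\<close> by (metis finite.emptyI ex_in_conv)
  then have "0 \<in> distance_set M d"
    unfolding distance_set_def by (auto intro!: exI[of _ x])
  then show ?thesis
    using finite_large_distances ex_small_distance assms by (simp add: decreases_to_zero_def)
qed

end

section \<open>Realising a set as a distance set\<close>

text \<open>The map \<open>h\<close> labels the points by the elements of the set that is to be realised, and
  distinct points are separated by the larger of their two labels. Labels of
  points of the space will be nonnegative; the absolute values make the function nonnegative on the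
  whole type, as \<^locale>\<open>Metric_space\<close> demands.\<close>

definition max_dist :: "('b \<Rightarrow> real) \<Rightarrow> 'b \<Rightarrow> 'b \<Rightarrow> real" where
  "max_dist h x y = (if x = y then 0 else max \<bar>h x\<bar> \<bar>h y\<bar>)"

text \<open>Injectivity keeps distinct points at a positive distance: at most one label is 0.\<close>

lemma Ultrametric_space_max_dist:
  assumes "inj_on h X"
  shows "Ultrametric_space X (max_dist h)"
proof
  fix x y z
  show "0 \<le> max_dist h x y" "max_dist h x y = max_dist h y x"
    by (auto simp: max_dist_def)
  assume xy: "x \<in> X" "y \<in> X"
  show "max_dist h x y = 0 \<longleftrightarrow> x = y"
  proof
    assume 0: "max_dist h x y = 0"
    show "x = y"
    proof (rule ccontr)
      assume "x \<noteq> y"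
      with 0 have "h x = h y"
        by (simp add: max_dist_def max_def split: if_splits)
      with assms xy \<open>x \<noteq> y\<close> show False
        by (blast dest: inj_onD)
    qed
  qed (simp add: max_dist_def)
  show "max_dist h x z \<le> max_dist h x y + max_dist h y z"
    "max_dist h x y \<le> max (max_dist h x z) (max_dist h z y)"
    by (auto simp: max_dist_def max_def)
qed

text \<open>The point labelled 0 realises every label as a distance.\<close>

lemma distance_set_max_dist:
  assumes h: "bij_betw h X A" and A: "A \<subseteq> {0..}" "0 \<in> A"
  shows "distance_set X (max_dist h) = A"
proof
  have label: "h x \<in> A" "\<bar>h x\<bar> = h x" if "x \<in> X" for x
  proof -
    show "h x \<in> A" using h that by (auto simp: bij_betw_def)
    with A(1) show "\<bar>h x\<bar> = h x" by auto
  qed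
  then show "distance_set X (max_dist h) \<subseteq> A"
    using A(2) by (auto simp: distance_set_def max_dist_def max_def)
  obtain p where p: "p \<in> X" "h p = 0"
    using h A(2) by (force simp: bij_betw_def)
  show "A \<subseteq> distance_set X (max_dist h)"
  proof
    fix a assume "a \<in> A"
    then obtain x where x: "x \<in> X" "h x = a"
      using h by (force simp: bij_betw_def)
    have "0 \<le> a" using A(1) \<open>a \<in> A\<close> by auto
    with x p have "max_dist h x p = a"
      by (auto simp: max_dist_def)
    then show "a \<in> distance_set X (max_dist h)"
      unfolding distance_set_def using x(1) p(1) by auto
  qed
qed

lemma mtotally_bounded_max_dist:
  assumes h: "bij_betw h X A" and A: "A \<subseteq> {0..}" "0 \<in> A"
    and fin: "\<And>r. 0 < r \<Longrightarrow> finite {a \<in> A. r \<le> a}"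
  shows "Metric_space.mtotally_bounded X (max_dist h) X"
proof -
  have inj: "inj_on h X" using h by (simp add: bij_betw_def)
  interpret Ultrametric_space X "max_dist h"
    using Ultrametric_space_max_dist[OF inj] .
  obtain p where p: "p \<in> X" "h p = 0"
    using h A(2) by (force simp: bij_betw_def)
  show ?thesis
    unfolding mtotally_bounded_def
  proof (intro allI impI)
    fix r :: real assume "0 < r"
    \<comment> \<open>The points with a label below \<open>r\<close> lie in the ball around \<open>p\<close>.\<close>
    define K where "K = insert p {x \<in> X. r \<le> h x}"
    have "h ` {x \<in> X. r \<le> h x} \<subseteq> {a \<in> A. r \<le> a}"
      using h by (auto simp: bij_betw_def)
    then have "finite (h ` {x \<in> X. r \<le> h x})"
      using fin[OF \<open>0 < r\<close>] by (rule finite_subset)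
    moreover have "inj_on h {x \<in> X. r \<le> h x}"
      using inj by (rule inj_on_subset) auto
    ultimately have "finite {x \<in> X. r \<le> h x}"
      by (rule finite_imageD)
    then have "finite K"
      by (simp add: K_def)
    moreover have "K \<subseteq> X"
      using p by (auto simp: K_def)
    moreover have "X \<subseteq> (\<Union>x\<in>K. mball x r)"
    proof
      fix x assume x: "x \<in> X"
      show "x \<in> (\<Union>x\<in>K. mball x r)"
      proof (cases "r \<le> h x")
        case True
        with x \<open>0 < r\<close> show ?thesis by (auto simp: K_def)
      next
        case False
        have "h x \<in> A" using h x by (auto simp: bij_betw_def)
        then have "0 \<le> h x" using A(1) by auto
        with False \<open>0 < r\<close> p have "max_dist h p x < r"
          by (auto simp: max_dist_def)
        with x p(1) show ?thesis by (auto simp: K_def in_mball)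
      qed
    qed
    ultimately show "\<exists>K. finite K \<and> K \<subseteq> X \<and> X \<subseteq> (\<Union>x\<in>K. mball x r)"
      by blast
  qed
qed

lemma ex_ultrametric_space_if_decreases_to_zero:
  assumes inf: "infinite (UNIV :: 'a set)" and A: "A \<subseteq> {0..}" "decreases_to_zero A"
  shows "\<exists>(X :: 'a set) d. Ultrametric_space X d \<and> infinite X \<and>
           Metric_space.mtotally_bounded X d X \<and> A = distance_set X d"
proof -
  have infA: "infinite A"
    using infinite_positive_part[OF A(2)] by (auto elim: contrapos_nn)
  obtain e :: "nat \<Rightarrow> 'a" where e: "inj e"
    using inf infinite_countable_subset by blast
  have "bij_betw (to_nat_on A) A UNIV"
    using countable_decreases_to_zero[OF A] infA by (rule to_nat_on_infinite)
  moreover have "bij_betw e UNIV (range e)"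
    using e by (rule inj_on_imp_bij_betw)
  ultimately have "bij_betw (e \<circ> to_nat_on A) A (range e)"
    by (rule bij_betw_trans)
  then obtain h where h: "bij_betw h (range e) A"
    using bij_betw_inv by blast
  have zero: "0 \<in> A" and fin: "\<And>r. 0 < r \<Longrightarrow> finite {a \<in> A. r \<le> a}"
    using A(2) by (auto simp: decreases_to_zero_def)
  have "infinite (range e)"
    using e by (rule range_inj_infinite)
  moreover have "Ultrametric_space (range e) (max_dist h)"
    using h by (intro Ultrametric_space_max_dist) (simp add: bij_betw_def)
  ultimately show ?thesis
    using distance_set_max_dist[OF h A(1) zero] mtotally_bounded_max_dist[OF h A(1) zero fin]
    by blast
qed

theorem theorem3p6:
  fixes A :: "real set"
  assumes "infinite (UNIV :: 'a set)"
    and "A \<subseteq> {0..}"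
  shows "(\<exists>(X :: 'a set) d. Ultrametric_space X d \<and> infinite X \<and>
            Metric_space.mtotally_bounded X d X \<and> A = distance_set X d)
         \<longleftrightarrow> has_order_type_one_plus_omega_star A \<and> accumulation_point_of 0 A"
  unfolding order_type_accumulating_at_zero_iff[OF assms(2)]
  using ex_ultrametric_space_if_decreases_to_zero[OF assms]
    Ultrametric_space.distance_set_decreases_to_zero by blast

end
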